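(* Let $p \ge 3$ be a prime with $p \equiv 3 \pmod 4$. Then $p$ has exactly one solution of the form $(x_1, x_1, z_1)$ (i.e. with $x = y$) and exactly one solution of the form $(x_2, y_2, y_2)$ (i.e. with $y = z$), and these satisfy $x_1 = 2x_2$ and $2z_1 = z_2$. If $p \ge 3$ is a prime with $p \not\equiv 3 \pmod 4$, then $p$ has no solution with $x = y$ and no solution with $y = z$.
   Context: For a positive integer $p$, a solution for $p$ is a triple $(x,y,z)$ of positive integers with $x \le y \le z$ and $\frac{4}{p} = \frac{1}{x} + \frac{1}{y} + \frac{1}{z}$. *)

theory Defs
  imports Complex_Main "HOL-Number_Theory.Cong" "HOL-Computational_Algebra.Primes"
begin

definition solutions :: "nat \<Rightarrow> (nat \<times> nat \<times> nat) set" where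
  "solutions p = {(x, y, z). 0 < x \<and> x \<le> y \<and> y \<le> z \<and>
     4 / rat_of_nat p = 1 / rat_of_nat x + 1 / rat_of_nat y + 1 / rat_of_nat z}"

end

(*
  Both kinds of solution come from 4/p = 2/a + 1/b. As p is odd, a = 2c is even and the
  equation becomes 4bc = p(b + c). Then p divides one of b, c; writing that one as pk and the
  other as km, one gets 4km = p + m, so m divides p, and parity rules out m = p. Hence
  4k = p + 1 and {b, c} = {k, pk}.
*)
theory Submission
  imports Defs
begin

lemma egyptian_half_divisible:
  fixes p b c :: nat
  assumes p: "prime p" "odd p" and c: "0 < c"
    and eq: "4 * b * c = p * (b + c)" and dvd: "p dvd b"
  shows "4 * c = p + 1 \<and> b = p * c"
proof -
  have p0: "p > 0" using p(1) prime_gt_0_nat by blast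
  obtain k where k: "b = p * k" using dvd by blast
  have "p * (4 * k * c) = p * (p * k + c)" using eq k by (simp add: algebra_simps)
  then have e1: "4 * k * c = p * k + c" using p0 by simp
  then have k0: "k > 0" using c by (cases k) auto
  \<comment> \<open>\<open>k\<close> divides both \<open>4 * k * c\<close> and \<open>p * k\<close>,
    hence also the remaining summand \<open>c\<close> of \<open>e1\<close>.\<close>
  have "k dvd c"
    using e1 by (metis dvd_add_right_iff dvd_triv_left dvd_triv_right mult.assoc mult.left_commute)
  then obtain m where m: "c = k * m" by blast
  have "k * (4 * k * m) = k * (p + m)" using e1 m by (simp add: algebra_simps)
  then have e2: "4 * k * m = p + m" using k0 by simp
  then have "m dvd p"
    by (metis dvd_add_left_iff dvd_refl dvd_triv_right)
  then have "m = 1 \<or> m = p" using p(1) prime_nat_iff by blast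
  moreover have "m \<noteq> p"
  proof
    assume "m = p"
    \<comment> \<open>With \<open>m = p\<close> the right side of \<open>e2\<close> becomes
      \<open>2 * p\<close>; cancelling \<open>p\<close> leaves an equation that is impossible modulo
      4.\<close>
    then have "p * (4 * k) = p * 2" using e2 by (simp add: algebra_simps)
    then have "4 * k = 2" using p0 by (metis mult_cancel1 neq0_conv)
    then show False by presburger
  qed
  ultimately show ?thesis using e2 k m by simp
qed

text \<open>An odd prime does not divide 4, so \<open>p\<close> must divide \<open>b\<close> or
  \<open>c\<close>. The equation is symmetric in these two, so the divisible case applies either
  directly or with the roles exchanged.\<close>

lemma egyptian_two_terms:
  fixes p b c :: nat
  assumes p: "prime p" "odd p" and "0 < b" "0 < c"
    and eq: "4 * b * c = p * (b + c)"
  shows "4 * c = p + 1 \<and> b = p * c \<or> 4 * b = p + 1 \<and> c = p * b"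
proof -
  have "p dvd 4 * b * c" using eq by simp
  moreover have "\<not> p dvd 4"
  proof
    assume "p dvd 4"
    then have "p dvd 2 ^ 2" by simp
    then have "p dvd 2" using p(1) prime_dvd_power by blast
    then show False using p by (metis primes_dvd_imp_eq two_is_prime_nat even_numeral)
  qed
  ultimately consider "p dvd b" | "p dvd c"
    using p(1) by (auto simp: prime_dvd_mult_iff)
  then show ?thesis
  proof cases
    case 1
    then show ?thesis using egyptian_half_divisible[OF p assms(4) eq] by blast
  next
    case 2
    have "4 * c * b = p * (c + b)" using eq by (simp add: algebra_simps)
    then show ?thesis using egyptian_half_divisible[OF p assms(3) _ 2] by blast
  qed
qed

text \<open>Handles \<open>x = y\<close> and \<open>y = z\<close> together: \<open>a\<close> is the
  repeated denominator and \<open>b\<close> the other one. No order between them is assumed, which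
  is why two alternatives remain.\<close>

lemma egyptian_repeated_iff:
  fixes p a b :: nat
  assumes p: "prime p" "odd p" and a: "0 < a" and b: "0 < b"
  shows "4 / rat_of_nat p = 2 / rat_of_nat a + 1 / rat_of_nat b \<longleftrightarrow>
    (\<exists>k. 4 * k = p + 1 \<and> (a = 2 * k \<and> b = p * k \<or> a = 2 * (p * k) \<and> b = k))"
proof -
  have p0: "p > 0" using p(1) prime_gt_0_nat by blast
  have "4 / rat_of_nat p = 2 / rat_of_nat a + 1 / rat_of_nat b \<longleftrightarrow>
      rat_of_nat (4 * a * b) = rat_of_nat (p * (2 * b + a))"
    using a b p0 by (simp add: field_simps)
  also have "\<dots> \<longleftrightarrow> 4 * a * b = p * (2 * b + a)"
    by (rule of_nat_eq_iff)
  also have "\<dots> \<longleftrightarrow>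
    (\<exists>k. 4 * k = p + 1 \<and> (a = 2 * k \<and> b = p * k \<or> a = 2 * (p * k) \<and> b = k))"
  proof
    assume eq: "4 * a * b = p * (2 * b + a)"
    have "even (p * (2 * b + a))" unfolding eq[symmetric] by simp
    then have "even a" using p(2) by simp
    then obtain c where c: "a = 2 * c" by blast
    have "4 * b * c = p * (b + c)" using eq c by (simp add: algebra_simps)
    then have "4 * c = p + 1 \<and> b = p * c \<or> 4 * b = p + 1 \<and> c = p * b"
      using egyptian_two_terms[OF p b, of c] a c by simp
    then show "\<exists>k. 4 * k = p + 1 \<and> (a = 2 * k \<and> b = p * k \<or> a = 2 * (p * k) \<and> b = k)"
      using c by blast
  next
    assume "\<exists>k. 4 * k = p + 1 \<and> (a = 2 * k \<and> b = p * k \<or> a = 2 * (p * k) \<and> b = k)"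
    then obtain k where k: "4 * k = p + 1"
      and ab: "a = 2 * k \<and> b = p * k \<or> a = 2 * (p * k) \<and> b = k" by blast
    \<comment> \<open>Both alternatives have the same product \<open>a * b = 2 * p * k * k\<close>
      and the same sum \<open>2 * b + a = 2 * k * (p + 1)\<close>, so one computation verifies
      both.\<close>
    have "4 * a * b = 2 * (p * k) * (4 * k)" using ab by auto
    also have "\<dots> = p * (2 * b + a)" unfolding k using ab by (auto simp: algebra_simps)
    finally show "4 * a * b = p * (2 * b + a)" .
  qed
  finally show ?thesis .
qed

text \<open>The repeated denominator must be the smaller one. Since \<open>p \<ge> 3\<close>, this
  holds for the pair \<open>2 * k\<close>, \<open>p * k\<close> and fails for
  \<open>2 * (p * k)\<close>, \<open>k\<close>.\<close>

lemma solutions_first_two_equal_iff: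
  fixes p x z :: nat
  assumes p: "prime p" "odd p"
  shows "(x, x, z) \<in> solutions p \<longleftrightarrow> (\<exists>k. 4 * k = p + 1 \<and> x = 2 * k \<and> z = p * k)"
proof -
  have p3: "p \<ge> 3" using p by (metis prime_ge_2_nat Suc_leI eval_nat_numeral(3) le_neq_implies_less dvd_refl)
  have "(x, x, z) \<in> solutions p \<longleftrightarrow> 0 < x \<and> 0 < z \<and> x \<le> z \<and>
      4 / rat_of_nat p = 2 / rat_of_nat x + 1 / rat_of_nat z"
    by (auto simp: solutions_def)
  also have "\<dots> \<longleftrightarrow> 0 < x \<and> 0 < z \<and> x \<le> z \<and>
      (\<exists>k. 4 * k = p + 1 \<and> (x = 2 * k \<and> z = p * k \<or> x = 2 * (p * k) \<and> z = k))"
    using egyptian_repeated_iff[OF p] by blast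
  also have "\<dots> \<longleftrightarrow> (\<exists>k. 4 * k = p + 1 \<and> x = 2 * k \<and> z = p * k)"
  proof -
    have "k > 0 \<and> 0 < p * k \<and> 2 * k \<le> p * k \<and> \<not> 2 * (p * k) \<le> k" if "4 * k = p + 1" for k
    proof -
      have "k > 0" using that by simp
      moreover have "3 * k \<le> p * k" using p3 by (rule mult_le_mono1)
      ultimately show ?thesis by linarith
    qed
    then show ?thesis by fastforce
  qed
  finally show ?thesis .
qed

text \<open>Now the repeated denominator must be the larger one, so the order selects the opposite
  alternative; \<open>3 * k \<le> p * k\<close> with \<open>k > 0\<close> makes
  \<open>2 * k < p * k\<close> strict.\<close>

lemma solutions_last_two_equal_iff:
  fixes p x y :: nat
  assumes p: "prime p" "odd p"
  shows "(x, y, y) \<in> solutions p \<longleftrightarrow> (\<exists>k. 4 * k = p + 1 \<and> x = k \<and> y = 2 * (p * k))"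
proof -
  have p3: "p \<ge> 3" using p by (metis prime_ge_2_nat Suc_leI eval_nat_numeral(3) le_neq_implies_less dvd_refl)
  have "(x, y, y) \<in> solutions p \<longleftrightarrow> 0 < y \<and> 0 < x \<and> x \<le> y \<and>
      4 / rat_of_nat p = 2 / rat_of_nat y + 1 / rat_of_nat x"
    by (auto simp: solutions_def)
  also have "\<dots> \<longleftrightarrow> 0 < y \<and> 0 < x \<and> x \<le> y \<and>
      (\<exists>k. 4 * k = p + 1 \<and> (y = 2 * k \<and> x = p * k \<or> y = 2 * (p * k) \<and> x = k))"
    using egyptian_repeated_iff[OF p] by blast
  also have "\<dots> \<longleftrightarrow> (\<exists>k. 4 * k = p + 1 \<and> x = k \<and> y = 2 * (p * k))"
  proof -
    have "k > 0 \<and> 0 < p * k \<and> \<not> p * k \<le> 2 * k \<and> k \<le> 2 * (p * k)" if "4 * k = p + 1" for k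
    proof -
      have "k > 0" using that by simp
      moreover have "3 * k \<le> p * k" using p3 by (rule mult_le_mono1)
      ultimately show ?thesis by linarith
    qed
    then show ?thesis by fastforce
  qed
  finally show ?thesis .
qed

theorem mainTheorem6:
  fixes p :: nat
  assumes "prime p" and "p \<ge> 3"
  shows "([p = 3] (mod 4) \<longrightarrow>
           (\<exists>!s. s \<in> solutions p \<and> (\<exists>x1 z1. s = (x1, x1, z1))) \<and>
           (\<exists>!s. s \<in> solutions p \<and> (\<exists>x2 y2. s = (x2, y2, y2))) \<and>
           (\<forall>x1 y1 z1 x2 y2 z2.
              (x1, y1, z1) \<in> solutions p \<and> x1 = y1 \<and>
              (x2, y2, z2) \<in> solutions p \<and> y2 = z2 \<longrightarrow>
              x1 = 2 * x2 \<and> 2 * z1 = z2)) \<and>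
         (\<not> [p = 3] (mod 4) \<longrightarrow>
           \<not> (\<exists>x y z. (x, y, z) \<in> solutions p \<and> x = y) \<and>
           \<not> (\<exists>x y z. (x, y, z) \<in> solutions p \<and> y = z))"
proof -
  have odd: "odd p" using assms prime_odd_nat by force
  note first_two = solutions_first_two_equal_iff[OF assms(1) odd]
    and last_two = solutions_last_two_equal_iff[OF assms(1) odd]
  \<comment> \<open>The congruence says that 4 divides \<open>p + 1\<close>, which is exactly the
    existence condition in \<open>first_two\<close> and \<open>last_two\<close>.\<close>
  have cong: "[p = 3] (mod 4) \<longleftrightarrow> (\<exists>k. 4 * k = p + 1)"
    unfolding cong_def by presburger
  show ?thesis
  proof (intro conjI impI)
    assume "[p = 3] (mod 4)"
    then obtain k where k: "4 * k = p + 1" using cong by blast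
    \<comment> \<open>As \<open>p\<close> determines \<open>k\<close>, each of the two shapes admits
      only one triple.\<close>
    have unique: "j = k" if "4 * j = p + 1" for j using that k by simp
    show "\<exists>!s. s \<in> solutions p \<and> (\<exists>x1 z1. s = (x1, x1, z1))"
      by (rule ex1I[of _ "(2 * k, 2 * k, p * k)"]) (use k unique in \<open>auto simp: first_two\<close>)
    show "\<exists>!s. s \<in> solutions p \<and> (\<exists>x2 y2. s = (x2, y2, y2))"
      by (rule ex1I[of _ "(k, 2 * (p * k), 2 * (p * k))"]) (use k unique in \<open>auto simp: last_two\<close>)
    \<comment> \<open>The same \<open>k\<close> parametrises both triples,
      \<open>(2 * k, 2 * k, p * k)\<close> and \<open>(k, 2 * (p * k), 2 * (p * k))\<close>, so the
      relations can be read off.\<close>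
    show "\<forall>x1 y1 z1 x2 y2 z2.
              (x1, y1, z1) \<in> solutions p \<and> x1 = y1 \<and>
              (x2, y2, z2) \<in> solutions p \<and> y2 = z2 \<longrightarrow>
              x1 = 2 * x2 \<and> 2 * z1 = z2"
      using unique by (auto simp: first_two last_two)
  next
    assume "\<not> [p = 3] (mod 4)"
    then show "\<not> (\<exists>x y z. (x, y, z) \<in> solutions p \<and> x = y)"
      and "\<not> (\<exists>x y z. (x, y, z) \<in> solutions p \<and> y = z)"
      using cong by (auto simp: first_two last_two)
  qed
qed

end
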